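(* Let $\mathcal K=\mathcal K_1\times\cdots\times\mathcal K_n\subset\mathbb R^{\bar n}$, where each $\mathcal K_i\subseteq\mathbb R^{d_i}$ is a half-line or a second-order cone, let $A\in\mathbb R^{m\times\bar n}$ have linearly independent rows, and let $\mathcal F=\{x\in\mathcal K: Ax=0,\ \|x\|_\infty\le1\}$. Suppose $x\in\mathcal F$. Suppose that $y\in\mathcal K$ satisfies $$2\sqrt n\,\|P_Ay\|\le y_{k0}$$ for some index $k$. Then: - if $\mathcal K_k$ is a half-line, then $\mathcal F_k\subseteq\left[0,\frac1{\sqrt2}\right]$; - if $\mathcal K_k$ is a second-order cone, then $$\mathcal F_k\subseteq H\left(y_k,\tfrac1{\sqrt2}e_k\right)\cap\mathcal K_k=\mathcal C\left(y_k,\tfrac1{\sqrt2}e_k\right).$$ In other words, any $x\in\mathcal F$ satisfies $x_k\in[0,1/\sqrt2]$ if $\mathcal K_k$ is a half-line, and $x_k\in\mathcal C(y_k,e_k/\sqrt2)$ if $\mathcal K_k$ is a second-order cone.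
   Context: A half-line is $\{x\in\mathbb R: x\ge 0\}$ ($d_i=1$); the second-order cone in $\mathbb R^{d_i}$, $d_i\ge2$, is $\{(x_0;x_1)\in\mathbb R\times\mathbb R^{d_i-1}:\|x_1\|\le x_0\}$ with the Euclidean norm. $\bar n=\sum_{i=1}^n d_i$. Vectors $x\in\mathbb R^{\bar n}$ are split into blocks $x=(x_1;\dots;x_n)$, $x_i\in\mathbb R^{d_i}$; for a second-order cone block $x_i=(x_{i0};x_{i1})\in\mathbb R\times\mathbb R^{d_i-1}$, and for a half-line block $x_{i0}$ means $x_i$. $\mathcal F_k=\{x_k: x\in\mathcal F\}$ is the projection of $\mathcal F$ onto block $k$. $P_A=I-A^T(AA^T)^{-1}A$ is the orthogonal projection onto $\mathrm{Ker}(A)$. For a second-order cone block, $e_k=(1;0)\in\mathbb R\times\mathbb R^{d_k-1}$, and for $w,v\in\mathbb R^{d_k}$, $H(w,v)=\{x\in\mathbb R^{d_k}: w^Tx\le w^Tv\}$ and $\mathcal C(w,v)=H(w,v)\cap\mathcal K_k$.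
   Formalization: In the half-line case it is additionally assumed that y_k is nonzero; without this the claim fails, e.g. for y = 0, three half-lines, A = (1, -1, 0), k = 3, where F_3 = [0,1]. *)

theory Defs
  imports
    Complex_Main
    "Jordan_Normal_Form.Gauss_Jordan_Elimination"
    "Jordan_Normal_Form.VS_Connect"
begin

text \<open>
  Blocks are numbered from 0, and coordinate 0 of a block is its leading coordinate
  (written $x_{i0}$ on paper). A half-line is a set of vectors of dimension 1.
\<close>

definition euclid_norm :: "real vec \<Rightarrow> real" where
  "euclid_norm v = sqrt (v \<bullet> v)"

definition sup_norm :: "real vec \<Rightarrow> real" where
  "sup_norm v = Max (insert 0 ((\<lambda>i. \<bar>v $ i\<bar>) ` {..<dim_vec v}))"

definition half_line :: "real vec set" where
  "half_line = {x \<in> carrier_vec 1. x $ 0 \<ge> 0}"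

definition vec_tail :: "real vec \<Rightarrow> real vec" where
  "vec_tail x = vec (dim_vec x - 1) (\<lambda>j. x $ (j + 1))"

text \<open>Only meant for dimension at least 2.\<close>

definition second_order_cone :: "nat \<Rightarrow> real vec set" where
  "second_order_cone p = {x \<in> carrier_vec p. euclid_norm (vec_tail x) \<le> x $ 0}"

definition total_dim :: "nat \<Rightarrow> (nat \<Rightarrow> nat) \<Rightarrow> nat" where
  "total_dim n d = (\<Sum>i<n. d i)"

definition vec_block :: "(nat \<Rightarrow> nat) \<Rightarrow> nat \<Rightarrow> real vec \<Rightarrow> real vec" where
  "vec_block d i x = vec (d i) (\<lambda>j. x $ ((\<Sum>l<i. d l) + j))"

definition product_cone :: "nat \<Rightarrow> (nat \<Rightarrow> nat) \<Rightarrow> (nat \<Rightarrow> real vec set) \<Rightarrow> real vec set" where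
  "product_cone n d K = {x \<in> carrier_vec (total_dim n d). \<forall>i<n. vec_block d i x \<in> K i}"

definition feasible_set ::
    "nat \<Rightarrow> (nat \<Rightarrow> nat) \<Rightarrow> (nat \<Rightarrow> real vec set) \<Rightarrow> real mat \<Rightarrow> real vec set" where
  "feasible_set n d K A =
     {x \<in> product_cone n d K. A *\<^sub>v x = 0\<^sub>v (dim_row A) \<and> sup_norm x \<le> 1}"

text \<open>
  Linear independence of the rows as a family: the library notion is about sets of vectors,
  so repeated rows have to be excluded separately.
\<close>

definition independent_rows :: "real mat \<Rightarrow> bool" where
  "independent_rows A \<longleftrightarrow> distinct (rows A) \<and>
     module.lin_indpt class_ring (module_vec TYPE(real) (dim_col A)) (set (rows A))"

text \<open>
  The inverse exists (so \<^const>\<open>mat_inverse\<close> is not \<^const>\<open>None\<close>) when the rows of A are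
  linearly independent.
\<close>

definition kernel_projection :: "real mat \<Rightarrow> real mat" where
  "kernel_projection A =
     1\<^sub>m (dim_col A) - transpose_mat A * the (mat_inverse (A * transpose_mat A)) * A"

definition half_space :: "real vec \<Rightarrow> real vec \<Rightarrow> real vec set" where
  "half_space w v = {x \<in> carrier_vec (dim_vec w). w \<bullet> x \<le> w \<bullet> v}"

definition cone_cut :: "real vec set \<Rightarrow> real vec \<Rightarrow> real vec \<Rightarrow> real vec set" where
  "cone_cut C w v = half_space w v \<inter> C"

end

theory Submission
  imports
    Defs
    "Jordan_Normal_Form.DL_Rank"
    "HOL-Analysis.L2_Norm"
begin

text \<open>
  Every cone is self-dual, so for feasible x the product of the k-th blocks of y and x is at most
  the full product of y and x. The latter equals the product of the projection of y with x,
  because x lies in the kernel of A. The Cauchy-Schwarz inequality bounds it by the norm of the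
  projection times the norm of x, and the norm of x is at most $\sqrt{2n}$: inside a cone the norm
  of a block is at most $\sqrt 2$ times its leading coordinate, which is at most 1.
\<close>

section \<open>Euclidean norm and Cauchy-Schwarz inequality\<close>

lemma scalar_prod_self_nonneg: "(v :: real vec) \<bullet> v \<ge> 0"
  by (simp add: scalar_prod_def sum_nonneg)

lemma euclid_norm_nonneg: "euclid_norm v \<ge> 0"
  by (simp add: euclid_norm_def scalar_prod_self_nonneg)

lemma euclid_norm_power2: "(euclid_norm v)\<^sup>2 = v \<bullet> v"
  by (simp add: euclid_norm_def scalar_prod_self_nonneg)

text \<open>Makes the Cauchy-Schwarz inequality \<open>L2_set_mult_ineq\<close> applicable to
  vectors.\<close>

lemma euclid_norm_eq_L2_set: "euclid_norm v = L2_set (\<lambda>i. v $ i) {0..<dim_vec v}"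
  by (simp add: euclid_norm_def L2_set_def scalar_prod_def power2_eq_square)

lemma abs_scalar_prod_le_euclid_norm:
  assumes "dim_vec v = dim_vec w"
  shows "\<bar>v \<bullet> w\<bar> \<le> euclid_norm v * euclid_norm w"
proof -
  have "\<bar>v \<bullet> w\<bar> \<le> (\<Sum>i\<in>{0..<dim_vec w}. \<bar>v $ i\<bar> * \<bar>w $ i\<bar>)"
    unfolding scalar_prod_def abs_mult[symmetric] by (rule sum_abs)
  also have "\<dots> \<le> euclid_norm v * euclid_norm w"
    unfolding euclid_norm_eq_L2_set assms by (rule L2_set_mult_ineq)
  finally show ?thesis .
qed

lemma scalar_prod_self_eq_0_imp:
  fixes v :: "real vec"
  assumes "v \<in> carrier_vec n" and "v \<bullet> v = 0"
  shows "v = 0\<^sub>v n"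
  \<comment> \<open>Conjugation is the identity on real vectors.\<close>
  using conjugate_square_eq_0_vec[OF assms(1)] assms(2) by simp

lemma abs_index_le_sup_norm:
  assumes "i < dim_vec v"
  shows "\<bar>v $ i\<bar> \<le> sup_norm v"
  using assms unfolding sup_norm_def by (intro Max_ge) auto

section \<open>Decomposition of sums and scalar products into blocks\<close>

lemma sum_lessThan_sum_blocks:
  fixes g :: "nat \<Rightarrow> 'a :: comm_monoid_add" and d :: "nat \<Rightarrow> nat"
  shows "(\<Sum>t<(\<Sum>l<n. d l). g t) = (\<Sum>i<n. \<Sum>j<d i. g ((\<Sum>l<i. d l) + j))"
proof (induction n)
  case (Suc n)
  \<comment> \<open>Used with \<open>a\<close> the total length of the first \<open>n\<close>
    blocks, that is, the offset of the last block, and \<open>b\<close> its length.\<close>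
  have split: "(\<Sum>t<a + b. g t) = (\<Sum>t<a. g t) + (\<Sum>j<b. g (a + j))" for a b
    by (induction b) (simp_all add: add.assoc)
  show ?case
    by (simp add: Suc split)
qed simp

text \<open>\<open>\<bullet>\<close> sums over the indices of its second factor, so the dimension of
  \<open>y\<close> fixes the range that the blocks partition.\<close>

lemma scalar_prod_vec_blocks:
  assumes "y \<in> carrier_vec (total_dim n d)"
  shows "x \<bullet> y = (\<Sum>i<n. vec_block d i x \<bullet> vec_block d i y)"
  using assms sum_lessThan_sum_blocks[of "\<lambda>t. x $ t * y $ t" d n]
  by (simp add: scalar_prod_def vec_block_def total_dim_def atLeast0LessThan)

section \<open>Geometry of a single cone\<close>

lemma scalar_prod_vec_tail:
  fixes x y :: "real vec"
  assumes "x \<in> carrier_vec p" and "y \<in> carrier_vec p" and "p \<ge> 1"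
  shows "x \<bullet> y = x $ 0 * y $ 0 + vec_tail x \<bullet> vec_tail y"
proof -
  obtain q where "p = Suc q"
    using \<open>p \<ge> 1\<close> by (cases p) auto
  with assms show ?thesis
    by (simp add: scalar_prod_def vec_tail_def sum.atLeast0_lessThan_Suc_shift
        del: sum.op_ivl_Suc)
qed

text \<open>In dimension 1 the tail is empty and has norm 0. Both kinds of block can therefore be
  treated as second-order cones.\<close>

lemma half_line_eq_second_order_cone: "half_line = second_order_cone 1"
  by (auto simp: half_line_def second_order_cone_def euclid_norm_def vec_tail_def
      scalar_prod_def)

text \<open>The half of self-duality that is used: by Cauchy-Schwarz the tails contribute at least
  \<open>- (x $ 0 * y $ 0)\<close>, which the leading coordinates compensate.\<close>

lemma second_order_cone_scalar_prod_nonneg: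
  assumes x: "x \<in> second_order_cone p" and y: "y \<in> second_order_cone p" and p: "p \<ge> 1"
  shows "x \<bullet> y \<ge> 0"
proof -
  have dims: "x \<in> carrier_vec p" "y \<in> carrier_vec p"
    and tx: "euclid_norm (vec_tail x) \<le> x $ 0" and ty: "euclid_norm (vec_tail y) \<le> y $ 0"
    using x y by (auto simp: second_order_cone_def)
  have "\<bar>vec_tail x \<bullet> vec_tail y\<bar> \<le> euclid_norm (vec_tail x) * euclid_norm (vec_tail y)"
    using dims by (intro abs_scalar_prod_le_euclid_norm) (simp add: vec_tail_def)
  also have "\<dots> \<le> x $ 0 * y $ 0"
    using tx ty order_trans[OF euclid_norm_nonneg tx]
    by (intro mult_mono) (auto simp: euclid_norm_nonneg)
  finally show ?thesis
    using scalar_prod_vec_tail[OF dims p] by linarith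
qed

text \<open>Leading coordinate and tail each contribute at most
  \<open>(x $ 0)\<^sup>2\<close>.\<close>

lemma second_order_cone_scalar_prod_self_le:
  assumes x: "x \<in> second_order_cone p" and p: "p \<ge> 1"
  shows "x \<bullet> x \<le> 2 * (x $ 0)\<^sup>2"
proof -
  have dim: "x \<in> carrier_vec p" and tx: "euclid_norm (vec_tail x) \<le> x $ 0"
    using x by (auto simp: second_order_cone_def)
  have "vec_tail x \<bullet> vec_tail x \<le> (x $ 0)\<^sup>2"
    using power_mono[OF tx euclid_norm_nonneg, of 2] by (simp add: euclid_norm_power2)
  then show ?thesis
    using scalar_prod_vec_tail[OF dim dim p] by (simp add: power2_eq_square)
qed

section \<open>The Gram matrix and the projection onto the kernel\<close>

lemma independent_rows_transpose_kernel:
  assumes A: "A \<in> carrier_mat m N" and rows: "independent_rows A"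
    and v: "v \<in> carrier_vec m" and Av: "transpose_mat A *\<^sub>v v = 0\<^sub>v N"
  shows "v = 0\<^sub>v m"
proof (rule ccontr)
  assume "v \<noteq> 0\<^sub>v m"
  interpret vec_space "TYPE(real)" N .
  \<comment> \<open>The entries of \<open>v\<close> are the coefficients of a vanishing combination
    of the rows; as the rows are distinct, it is a dependency of the set of rows.\<close>
  have "lin_dep (set (cols (transpose_mat A)))"
    using A rows v Av \<open>v \<noteq> 0\<^sub>v m\<close>
    by (intro lin_depI[of _ m v]) (auto simp: independent_rows_def)
  with A rows show False
    by (auto simp: independent_rows_def)
qed

text \<open>If the Gram matrix kills \<open>v\<close>, then the squared norm of
  \<open>transpose_mat A *\<^sub>v v\<close> is 0, and independence of the rows forces
  \<open>v\<close> to vanish. Hence \<open>the\<close> in \<open>kernel_projection\<close> is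
  applied to a genuine inverse.\<close>

lemma independent_rows_mat_inverse_gram:
  assumes A: "A \<in> carrier_mat m N" and rows: "independent_rows A"
  obtains B where "mat_inverse (A * transpose_mat A) = Some B" and "B \<in> carrier_mat m m"
proof -
  let ?G = "A * transpose_mat A"
  have G: "?G \<in> carrier_mat m m"
    using A by simp
  have "det ?G \<noteq> 0"
  proof
    assume "det ?G = 0"
    then obtain v where v: "v \<in> carrier_vec m" "v \<noteq> 0\<^sub>v m" and Gv: "?G *\<^sub>v v = 0\<^sub>v m"
      unfolding det_0_iff_vec_prod_zero[OF G] by blast
    let ?w = "transpose_mat A *\<^sub>v v"
    have w: "?w \<in> carrier_vec N"
      using A v by simp
    have "A *\<^sub>v ?w = 0\<^sub>v m"
      using A v Gv by (metis assoc_mult_mat_vec transpose_carrier_mat)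
    then have "?w \<bullet> ?w = 0"
      using transpose_vec_mult_scalar[OF A w v(1)] v by simp
    then have "?w = 0\<^sub>v N"
      using scalar_prod_self_eq_0_imp[OF w] by blast
    with independent_rows_transpose_kernel[OF A rows v(1)] v show False
      by blast
  qed
  then have "mat_inverse ?G \<noteq> None"
    \<comment> \<open>\<open>mat_inverse\<close> returns \<open>None\<close> only on non-units;
      \<open>()\<close> fills the dummy parameter of the matrix ring.\<close>
    using det_non_zero_imp_unit[OF G, of "()"] mat_inverse(1)[OF G, of "()"] by blast
  with mat_inverse(2)[OF G] that show thesis
    by blast
qed

lemma kernel_projection_carrier [simp]:
  "A \<in> carrier_mat m N \<Longrightarrow> kernel_projection A \<in> carrier_mat N N"
  by (simp add: kernel_projection_def minus_mat_def)

text \<open>The projection changes \<open>y\<close> by a vector in the range of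
  \<open>transpose_mat A\<close>, and this range is orthogonal to the kernel of
  \<open>A\<close>.\<close>

lemma kernel_projection_scalar_prod:
  assumes A: "A \<in> carrier_mat m N" and rows: "independent_rows A"
    and x: "x \<in> carrier_vec N" and Ax: "A *\<^sub>v x = 0\<^sub>v m" and y: "y \<in> carrier_vec N"
  shows "(kernel_projection A *\<^sub>v y) \<bullet> x = y \<bullet> x"
proof -
  obtain B where B: "mat_inverse (A * transpose_mat A) = Some B" "B \<in> carrier_mat m m"
    using independent_rows_mat_inverse_gram[OF A rows] .
  let ?w = "B *\<^sub>v (A *\<^sub>v y)"
  have w: "?w \<in> carrier_vec m"
    using A B y by simp
  have "kernel_projection A *\<^sub>v y = y - transpose_mat A *\<^sub>v ?w"
    using A B y
    by (simp add: kernel_projection_def minus_mult_distrib_mat_vec[of _ N N]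
        assoc_mult_mat_vec[of _ N m _ N] assoc_mult_mat_vec[of _ N m _ m])
  then have "(kernel_projection A *\<^sub>v y) \<bullet> x = y \<bullet> x - (transpose_mat A *\<^sub>v ?w) \<bullet> x"
    using A w x y by (simp add: minus_scalar_prod_distrib[of _ N])
  also have "(transpose_mat A *\<^sub>v ?w) \<bullet> x = 0"
    using transpose_vec_mult_scalar[OF A x w] Ax w by simp
  finally show ?thesis
    by simp
qed

section \<open>Bounds on feasible points\<close>

lemma feasible_set_block_index_0_le_1:
  assumes "x \<in> feasible_set n d K A" and "i < n" and "d i \<ge> 1"
  shows "\<bar>vec_block d i x $ 0\<bar> \<le> 1"
proof -
  \<comment> \<open>The leading coordinate of block \<open>i\<close> sits at this offset, which must
    be a valid index for \<open>sup_norm\<close> to control it.\<close>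
  have "(\<Sum>l<i. d l) < total_dim n d"
  proof -
    have "(\<Sum>l<i. d l) + d i = (\<Sum>l<Suc i. d l)"
      by simp
    also have "\<dots> \<le> total_dim n d"
      unfolding total_dim_def using \<open>i < n\<close> by (intro sum_mono2) auto
    finally show ?thesis
      using \<open>d i \<ge> 1\<close> by simp
  qed
  then have "\<bar>x $ (\<Sum>l<i. d l)\<bar> \<le> sup_norm x"
    using assms(1) by (intro abs_index_le_sup_norm) (auto simp: feasible_set_def product_cone_def)
  then show ?thesis
    using assms by (auto simp: feasible_set_def vec_block_def)
qed

lemma feasible_set_euclid_norm_le:
  assumes cones: "\<And>i. i < n \<Longrightarrow> d i \<ge> 1 \<and> K i = second_order_cone (d i)"
    and x: "x \<in> feasible_set n d K A"
  shows "euclid_norm x \<le> sqrt 2 * sqrt (real n)"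
proof -
  have xK: "x \<in> product_cone n d K"
    using x by (simp add: feasible_set_def)
  have "vec_block d i x \<bullet> vec_block d i x \<le> 2" if "i < n" for i
  proof -
    have "vec_block d i x \<in> second_order_cone (d i)"
      using xK cones[OF that] that by (auto simp: product_cone_def)
    then have "vec_block d i x \<bullet> vec_block d i x \<le> 2 * (vec_block d i x $ 0)\<^sup>2"
      using cones[OF that] by (intro second_order_cone_scalar_prod_self_le) auto
    also have "\<dots> \<le> 2 * 1"
      using feasible_set_block_index_0_le_1[OF x that] cones[OF that]
      by (intro mult_left_mono) (auto simp: abs_square_le_1)
    finally show ?thesis
      by simp
  qed
  then have "(\<Sum>i<n. vec_block d i x \<bullet> vec_block d i x) \<le> (\<Sum>i<n. 2)"
    by (intro sum_mono) auto
  moreover have "x \<in> carrier_vec (total_dim n d)"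
    using xK by (simp add: product_cone_def)
  ultimately have "x \<bullet> x \<le> 2 * real n"
    by (simp add: scalar_prod_vec_blocks)
  then show ?thesis
    unfolding euclid_norm_def by (simp flip: real_sqrt_mult)
qed

lemma block_scalar_prod_le_feasible:
  assumes cones: "\<And>i. i < n \<Longrightarrow> d i \<ge> 1 \<and> K i = second_order_cone (d i)"
    and A: "A \<in> carrier_mat m (total_dim n d)" and rows: "independent_rows A"
    and x: "x \<in> feasible_set n d K A" and y: "y \<in> product_cone n d K" and k: "k < n"
    and small: "2 * sqrt (real n) * euclid_norm (kernel_projection A *\<^sub>v y) \<le> vec_block d k y $ 0"
  shows "vec_block d k y \<bullet> vec_block d k x \<le> vec_block d k y $ 0 / sqrt 2"
proof -
  let ?Py = "kernel_projection A *\<^sub>v y"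
  have xK: "x \<in> product_cone n d K" and Ax: "A *\<^sub>v x = 0\<^sub>v m"
    using x A by (auto simp: feasible_set_def)
  have dims: "x \<in> carrier_vec (total_dim n d)" "y \<in> carrier_vec (total_dim n d)"
    using xK y by (auto simp: product_cone_def)
  have nonneg: "vec_block d i y \<bullet> vec_block d i x \<ge> 0" if "i < n" for i
    using xK y that cones[OF that]
    by (intro second_order_cone_scalar_prod_nonneg[of _ "d i"]) (auto simp: product_cone_def)
  \<comment> \<open>By self-duality the other blocks only add nonnegative terms.\<close>
  have "vec_block d k y \<bullet> vec_block d k x \<le> (\<Sum>i<n. vec_block d i y \<bullet> vec_block d i x)"
    using k nonneg by (intro member_le_sum) auto
  also have "\<dots> = y \<bullet> x"
    using dims by (simp add: scalar_prod_vec_blocks)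
  also have "\<dots> = ?Py \<bullet> x"
    using kernel_projection_scalar_prod[OF A rows dims(1) Ax dims(2)] by simp
  also have "\<dots> \<le> euclid_norm ?Py * euclid_norm x"
    using abs_scalar_prod_le_euclid_norm[of ?Py x] dims kernel_projection_carrier[OF A] by simp
  also have "\<dots> \<le> euclid_norm ?Py * (sqrt 2 * sqrt (real n))"
    using feasible_set_euclid_norm_le[OF cones x]
    by (intro mult_left_mono euclid_norm_nonneg)
  \<comment> \<open>Writing \<open>sqrt 2\<close> as \<open>2 / sqrt 2\<close> exposes the left side
    of \<open>small\<close>; this is the origin of the factor \<open>1 / sqrt 2\<close> in the
    result.\<close>
  also have "\<dots> = (2 * sqrt (real n) * euclid_norm ?Py) / sqrt 2"
    by (simp add: field_simps)
  also have "\<dots> \<le> vec_block d k y $ 0 / sqrt 2"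
    using small by (intro divide_right_mono) auto
  finally show ?thesis .
qed

text \<open>On a half-line the block inequality must be divided by the leading coordinate of
  \<open>y\<close>, hence \<open>nonzero\<close>: for \<open>y = 0\<close> the condition
  \<open>small\<close> holds trivially and does not restrict block \<open>k\<close>.\<close>

theorem lemma3p1:
  fixes n m k :: nat
    and d :: "nat \<Rightarrow> nat"
    and K :: "nat \<Rightarrow> real vec set"
    and A :: "real mat"
    and x y :: "real vec"
  assumes cones: "\<And>i. i < n \<Longrightarrow>
      (d i = 1 \<and> K i = half_line) \<or> (d i \<ge> 2 \<and> K i = second_order_cone (d i))"
    and A: "A \<in> carrier_mat m (total_dim n d)"
    and rows: "independent_rows A"
    and x: "x \<in> feasible_set n d K A"
    and y: "y \<in> product_cone n d K"
    and k: "k < n"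
    and small: "2 * sqrt (real n) * euclid_norm (kernel_projection A *\<^sub>v y) \<le> vec_block d k y $ 0"
    and nonzero: "K k = half_line \<Longrightarrow> vec_block d k y $ 0 \<noteq> 0"
  shows "(K k = half_line \<longrightarrow>
            (\<lambda>v. v $ 0) ` (vec_block d k ` feasible_set n d K A) \<subseteq> {0 .. 1 / sqrt 2} \<and>
            vec_block d k x $ 0 \<in> {0 .. 1 / sqrt 2}) \<and>
         (K k = second_order_cone (d k) \<and> d k \<ge> 2 \<longrightarrow>
            vec_block d k ` feasible_set n d K A
              \<subseteq> half_space (vec_block d k y) ((1 / sqrt 2) \<cdot>\<^sub>v unit_vec (d k) 0) \<inter> K k \<and>
            half_space (vec_block d k y) ((1 / sqrt 2) \<cdot>\<^sub>v unit_vec (d k) 0) \<inter> K k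
              = cone_cut (K k) (vec_block d k y) ((1 / sqrt 2) \<cdot>\<^sub>v unit_vec (d k) 0) \<and>
            vec_block d k x
              \<in> cone_cut (K k) (vec_block d k y) ((1 / sqrt 2) \<cdot>\<^sub>v unit_vec (d k) 0))"
proof -
  have cones': "d i \<ge> 1 \<and> K i = second_order_cone (d i)" if "i < n" for i
    using cones[OF that] by (auto simp: half_line_eq_second_order_cone)
  \<comment> \<open>Stated for every feasible \<open>z\<close>, since the inclusions concern the
    whole projection onto block \<open>k\<close>.\<close>
  have bound: "vec_block d k y \<bullet> vec_block d k z \<le> vec_block d k y $ 0 / sqrt 2"
    if "z \<in> feasible_set n d K A" for z
    using block_scalar_prod_le_feasible[OF cones' A rows that y k small] .
  have cone_block: "vec_block d k z \<in> K k" if "z \<in> feasible_set n d K A" for z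
    using that k by (auto simp: feasible_set_def product_cone_def)
  have interval: "vec_block d k z $ 0 \<in> {0 .. 1 / sqrt 2}"
    if half: "K k = half_line" and z: "z \<in> feasible_set n d K A" for z
  proof -
    have "vec_block d k z \<in> carrier_vec 1" and z0: "vec_block d k z $ 0 \<ge> 0"
      using cone_block[OF z] half by (auto simp: half_line_def)
    \<comment> \<open>The dimension is read off from membership, so the scalar product of the blocks
      is a single product.\<close>
    then have "d k = 1"
      by (simp add: vec_block_def)
    then have "vec_block d k y $ 0 * vec_block d k z $ 0 \<le> vec_block d k y $ 0 * (1 / sqrt 2)"
      using bound[OF z] by (simp add: scalar_prod_def vec_block_def)
    moreover have "vec_block d k y $ 0 > 0"
      using nonzero[OF half] y k half by (force simp: product_cone_def half_line_def)
    ultimately have "vec_block d k z $ 0 \<le> 1 / sqrt 2"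
      by (rule mult_left_le_imp_le)
    then show ?thesis
      using z0 by simp
  qed
  have cut: "vec_block d k z \<in> half_space (vec_block d k y) ((1 / sqrt 2) \<cdot>\<^sub>v unit_vec (d k) 0) \<inter> K k"
    if z: "z \<in> feasible_set n d K A" for z
  proof -
    \<comment> \<open>The scaled unit vector picks out the leading coordinate, which exists because
      \<open>d k \<ge> 1\<close>.\<close>
    have "vec_block d k y \<bullet> ((1 / sqrt 2) \<cdot>\<^sub>v unit_vec (d k) 0) = vec_block d k y $ 0 / sqrt 2"
      using cones'[OF k] by (simp add: vec_block_def)
    then show ?thesis
      using bound[OF z] cone_block[OF z] by (simp add: half_space_def vec_block_def)
  qed
  show ?thesis
    using interval cut x by (auto simp: cone_cut_def)
qed

end
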